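(* Let $s\ge 1$ and $1\le k\le s$ be integers and let $\alpha\in(0,1)$. For testing $H_i: P\in\omega_i$, $i=1,\ldots,s$, suppose that each p-value $\hat p_i$ satisfies $$P\{\hat p_i\le u\}\le u\quad\text{for any } u\in(0,1)\text{ and any } P\in\omega_i .$$ Consider the procedure that rejects any $H_i$ for which $\hat p_i\le k\alpha/s$. (i) This procedure controls the $k$-FWER at level $\alpha$, that is, $$P\{\text{reject at least } k \text{ hypotheses } H_i \text{ with } i\in I(P)\}\le\alpha\quad\text{for all } P\in\Omega .$$ (ii) For this procedure, the inequality $P\{\text{reject at least } k \text{ hypotheses } H_i \text{ with } i\in I(P)\}\le\alpha$ is sharp in the sense that there exists a joint distribution for $(\hat p_1,\ldots,\hat p_s)$ (with the $\hat p_i$ satisfying $P\{\hat p_i\le u\}\le u$ for any $u\in(0,1)$ and any $P\in\omega_i$) for which equality is attained, i.e. for which the probability of rejecting at least $k$ true hypotheses equals $\alpha$.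
   Context: Data $X$ is available from some model $P\in\Omega$, where $\Omega$ is a family of probability distributions. A hypothesis $H_i$ is identified with a subset $\omega_i\subset\Omega$ and asserts $P\in\omega_i$. $I(P)=\{i: P\in\omega_i\}$ is the set of indices of true null hypotheses when $P$ is the true distribution. The p-values $\hat p_1,\ldots,\hat p_s$ are $[0,1]$-valued statistics (functions of $X$); no assumption is made on their joint dependence structure. The $k$-FWER (under $P$) is $P\{\text{reject at least } k \text{ hypotheses } H_i \text{ with } i\in I(P)\}$. *)

theory Defs
  imports "HOL-Probability.Probability"
begin

text \<open>Hypotheses and p-values are indexed by \<open>{1..s}\<close>; the values of \<open>\<omega>\<close> and \<open>p\<close> at other indices
  are irrelevant. The data \<open>X\<close> is the identity on the sample space, a distribution of \<open>X\<close> being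
  a probability measure on it. Of \<open>M\<close> only \<open>space M\<close> and \<open>sets M\<close> are used.\<close>

locale multiple_testing =
  fixes M :: "'a measure"
    and s :: nat
    and \<Omega> :: "'a measure set"
    and \<omega> :: "nat \<Rightarrow> 'a measure set"
    and p :: "nat \<Rightarrow> 'a \<Rightarrow> real"
  assumes model_prob_space: "P \<in> \<Omega> \<Longrightarrow> prob_space P"
    and model_sets: "P \<in> \<Omega> \<Longrightarrow> sets P = sets M"
    and hypothesis_subset: "i \<in> {1..s} \<Longrightarrow> \<omega> i \<subseteq> \<Omega>"
    and pvalue_measurable: "i \<in> {1..s} \<Longrightarrow> p i \<in> borel_measurable M"
    and pvalue_range: "i \<in> {1..s} \<Longrightarrow> x \<in> space M \<Longrightarrow> p i x \<in> {0..1}"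

definition valid_pvalues ::
    "nat \<Rightarrow> (nat \<Rightarrow> 'a measure set) \<Rightarrow> (nat \<Rightarrow> 'a \<Rightarrow> real) \<Rightarrow> bool" where
  "valid_pvalues s \<omega> p \<longleftrightarrow>
     (\<forall>i\<in>{1..s}. \<forall>u\<in>{0<..<1}. \<forall>P\<in>\<omega> i. measure P {x \<in> space P. p i x \<le> u} \<le> u)"

definition true_nulls :: "nat \<Rightarrow> (nat \<Rightarrow> 'a measure set) \<Rightarrow> 'a measure \<Rightarrow> nat set" where
  "true_nulls s \<omega> P = {i \<in> {1..s}. P \<in> \<omega> i}"

text \<open>A testing procedure \<open>R\<close> maps the data to the set of indices of the rejected hypotheses.\<close>

definition kFWER ::
    "nat \<Rightarrow> nat \<Rightarrow> (nat \<Rightarrow> 'a measure set) \<Rightarrow> ('a \<Rightarrow> nat set) \<Rightarrow> 'a measure \<Rightarrow> real" where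
  "kFWER k s \<omega> R P = measure P {x \<in> space P. k \<le> card (R x \<inter> true_nulls s \<omega> P)}"

definition single_step ::
    "nat \<Rightarrow> nat \<Rightarrow> real \<Rightarrow> (nat \<Rightarrow> 'a \<Rightarrow> real) \<Rightarrow> 'a \<Rightarrow> nat set" where
  "single_step k s \<alpha> p x = {i \<in> {1..s}. p i x \<le> real k * \<alpha> / real s}"

text \<open>The measurable space \<open>[0,1]\<^sup>s\<close> carrying the joint distributions of \<open>s\<close> p-values.\<close>

definition pvalue_space :: "nat \<Rightarrow> (nat \<Rightarrow> real) measure" where
  "pvalue_space s = PiM {1..s} (\<lambda>_. restrict_space borel {0..1})"

end

theory Submission imports Defs begin

text \<open>Bounding the \<open>k\<close>-FWER is Markov's inequality for the number of false rejections. Each true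
  null is rejected with probability at most \<open>k\<alpha>/s\<close>, and there are at most \<open>s\<close> of them, so the
  expected number of false rejections is at most \<open>k\<alpha>\<close>, whatever the dependence between the
  p-values; hence at least \<open>k\<close> of them occur with probability at most \<open>\<alpha>\<close>
  (\<open>real_mult_prob_card_ge_le_sum\<close>).

  Equality forces the number of false rejections to be \<open>k\<close> with probability \<open>\<alpha>\<close> and \<open>0\<close> otherwise.
  Such a distribution exists with all hypotheses true: with probability \<open>\<alpha>\<close>, a cyclic block of \<open>k\<close>
  consecutive indices is chosen uniformly among the \<open>s\<close> rotations, and its p-values are set to
  \<open>k\<alpha>/s\<close>; every other p-value is \<open>1\<close>. A given index lies in \<open>k\<close> of the \<open>s\<close> blocks
  (\<open>card_cyclic_block\<close>), so each p-value equals \<open>k\<alpha>/s\<close> with probability exactly \<open>k\<alpha>/s\<close>. Being a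
  two-point variable with the other atom at \<open>1\<close>, it satisfies the validity condition.\<close>

section \<open>Markov's inequality for the number of events that occur\<close>

lemma measurable_card_ge:
  assumes "finite I" and "\<And>i. i \<in> I \<Longrightarrow> A i \<in> sets M"
  shows "{x \<in> space M. k \<le> card {i \<in> I. x \<in> A i}} \<in> sets M"
proof -
  have eq: "real (card {i \<in> I. x \<in> A i}) = (\<Sum>i\<in>I. indicat_real (A i) x)" for x
    using assms(1) by (simp add: indicator_def sum.If_cases Int_def)
  have "(\<lambda>x. \<Sum>i\<in>I. indicat_real (A i) x) \<in> borel_measurable M"
    using assms(2) by (intro borel_measurable_sum borel_measurable_indicator)
  then have "{x \<in> space M. real k \<le> (\<Sum>i\<in>I. indicat_real (A i) x)} \<in> sets M"
    by measurable
  then show ?thesis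
    unfolding eq[symmetric] by simp
qed

text \<open>Markov's inequality in union-bound form: where at least \<open>k\<close> of the events occur, the sum of their
  indicators is at least \<open>k\<close>. Integrating this sum uses linearity only, so the joint behaviour of the
  events does not matter. The case \<open>k = 1\<close> is the union bound.\<close>

lemma (in finite_measure) real_mult_prob_card_ge_le_sum:
  assumes I: "finite I" and A: "\<And>i. i \<in> I \<Longrightarrow> A i \<in> sets M"
  shows "real k * measure M {x \<in> space M. k \<le> card {i \<in> I. x \<in> A i}} \<le> (\<Sum>i\<in>I. measure M (A i))"
proof -
  define E where "E = {x \<in> space M. k \<le> card {i \<in> I. x \<in> A i}}"
  have E: "E \<in> sets M"
    unfolding E_def using I A by (rule measurable_card_ge)
  have le: "real k * indicat_real E x \<le> (\<Sum>i\<in>I. indicat_real (A i) x)" for x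
  proof -
    have "(\<Sum>i\<in>I. indicat_real (A i) x) = real (card {i \<in> I. x \<in> A i})"
      using I by (simp add: indicator_def sum.If_cases Int_def)
    then show ?thesis
      by (simp add: E_def indicator_def)
  qed
  have "real k * measure M E = (\<integral>x. real k * indicat_real E x \<partial>M)"
    using E by simp
  also have "\<dots> \<le> (\<integral>x. (\<Sum>i\<in>I. indicat_real (A i) x) \<partial>M)"
    using E A le by (intro integral_mono integrable_mult_right Bochner_Integration.integrable_sum)
      (simp_all add: integrable_indicator_iff less_top[symmetric])
  also have "\<dots> = (\<Sum>i\<in>I. measure M (A i))"
    using A by (simp add: Bochner_Integration.integral_sum less_top[symmetric])
  finally show ?thesis
    unfolding E_def .
qed

section \<open>Control of the k-FWER\<close>

text \<open>The validity condition speaks of levels strictly between \<open>0\<close> and \<open>1\<close> only, so it applies at the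
  critical value because \<open>k\<alpha>/s\<close> lies there.\<close>

lemma critical_value_bounds:
  fixes \<alpha> :: real
  assumes "1 \<le> k" "k \<le> s" "0 < \<alpha>" "\<alpha> < 1"
  shows "0 < real k * \<alpha> / real s" and "real k * \<alpha> / real s < 1"
proof -
  show "0 < real k * \<alpha> / real s"
    using assms by simp
  have "real k * \<alpha> < real k * 1"
    using assms by (intro mult_strict_left_mono) auto
  also have "\<dots> \<le> real s"
    using assms by simp
  finally show "real k * \<alpha> / real s < 1"
    using assms by simp
qed

lemma kFWER_single_step_le:
  fixes \<alpha> :: real
  assumes "multiple_testing M s \<Omega> \<omega> p" and valid: "valid_pvalues s \<omega> p"
    and s: "1 \<le> k" "k \<le> s" and \<alpha>: "0 < \<alpha>" "\<alpha> < 1" and P: "P \<in> \<Omega>"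
  shows "kFWER k s \<omega> (single_step k s \<alpha> p) P \<le> \<alpha>"
proof -
  interpret multiple_testing M s \<Omega> \<omega> p by fact
  interpret P: prob_space P using P by (rule model_prob_space)
  define t where "t = real k * \<alpha> / real s"
  have t: "t \<in> {0<..<1}"
    using critical_value_bounds[OF s \<alpha>] by (simp add: t_def)
  define I where "I = true_nulls s \<omega> P"
  define A where "A = (\<lambda>i. {x \<in> space P. p i x \<le> t})"
  have I: "finite I" "I \<subseteq> {1..s}"
    by (auto simp: I_def true_nulls_def)
  have A: "A i \<in> sets P" if "i \<in> I" for i
  proof -
    have "p i \<in> borel_measurable P"
      using pvalue_measurable[of i] that I model_sets[OF P] measurable_cong_sets by blast
    then show ?thesis
      unfolding A_def by measurable
  qed
  have "single_step k s \<alpha> p x \<inter> true_nulls s \<omega> P = {i \<in> I. x \<in> A i}" if "x \<in> space P" for x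
    using that by (auto simp: single_step_def I_def A_def t_def true_nulls_def)
  then have "kFWER k s \<omega> (single_step k s \<alpha> p) P
      = measure P {x \<in> space P. k \<le> card {i \<in> I. x \<in> A i}}"
    unfolding kFWER_def by (intro arg_cong[where f = "measure P"]) auto
  then have "real k * kFWER k s \<omega> (single_step k s \<alpha> p) P \<le> (\<Sum>i\<in>I. measure P (A i))"
    using P.real_mult_prob_card_ge_le_sum[OF I(1) A] by simp
  also have "\<dots> \<le> (\<Sum>i\<in>I. t)"
    using valid t unfolding valid_pvalues_def A_def I_def true_nulls_def
    by (intro sum_mono) auto
  also have "\<dots> \<le> real s * t"
    using card_mono[OF _ I(2)] t by simp
  also have "\<dots> = real k * \<alpha>"
    using s by (simp add: t_def)
  finally show ?thesis
    using s by simp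
qed

section \<open>Cyclic blocks of indices\<close>

text \<open>Any \<open>s\<close> consecutive integers form a complete residue system modulo \<open>s\<close>. The shift \<open>c\<close> allows
  both readings of the condition \<open>(i + j) mod s < k\<close>: as a set of indices \<open>i \<in> {1..s}\<close> for a fixed
  rotation \<open>j\<close>, and as a set of rotations \<open>j \<in> {0..<s}\<close> for a fixed index \<open>i\<close>.\<close>

lemma card_cyclic_block:
  fixes a c k s :: nat
  assumes "k \<le> s"
  shows "card {i \<in> {a..<a + s}. (i + c) mod s < k} = k"
proof (cases "s = 0")
  case True
  then show ?thesis using assms by simp
next
  case False
  let ?f = "\<lambda>i. (i + c) mod s"
  have *: False if "i < j" "i \<in> {a..<a + s}" "j \<in> {a..<a + s}" "?f i = ?f j" for i j
  proof -
    have "s dvd (j + c) - (i + c)"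
      using that by (intro mod_eq_dvd_iff_nat[THEN iffD1]) auto
    with that show False
      by (auto dest!: dvd_imp_le)
  qed
  have inj: "inj_on ?f {a..<a + s}"
    using * by (intro inj_onI) (metis linorder_neq_iff)
  have surj: "?f ` {a..<a + s} = {..<s}"
  proof (rule card_subset_eq)
    show "card (?f ` {a..<a + s}) = card {..<s}"
      using inj by (simp add: card_image)
  qed (use False in auto)
  have "?f ` {i \<in> {a..<a + s}. ?f i < k} = ?f ` {a..<a + s} \<inter> {..<k}"
    by auto
  also have "\<dots> = {..<k}"
    using assms unfolding surj by auto
  finally have "?f ` {i \<in> {a..<a + s}. ?f i < k} = {..<k}" .
  moreover have "inj_on ?f {i \<in> {a..<a + s}. ?f i < k}"
    using inj by (rule inj_on_subset) auto
  ultimately show ?thesis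
    by (metis card_image card_lessThan)
qed

section \<open>The extremal joint distribution\<close>

text \<open>The coin \<open>b\<close> decides whether there are any small p-values, and \<open>j\<close> rotates the block of indices
  that receive them. The restriction to \<open>{1..s}\<close> makes the result a point of the product space, whose
  elements are \<open>undefined\<close> off the index set.\<close>

definition block_pvalues :: "nat \<Rightarrow> nat \<Rightarrow> real \<Rightarrow> bool \<times> nat \<Rightarrow> nat \<Rightarrow> real" where
  "block_pvalues k s t = (\<lambda>(b, j). \<lambda>i\<in>{1..s}. if b \<and> (i + j) mod s < k then t else 1)"

definition block_seed :: "nat \<Rightarrow> real \<Rightarrow> (bool \<times> nat) pmf" where
  "block_seed s \<alpha> = pair_pmf (bernoulli_pmf \<alpha>) (pmf_of_set {..<s})"

definition block_distr :: "nat \<Rightarrow> nat \<Rightarrow> real \<Rightarrow> (nat \<Rightarrow> real) measure" where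
  "block_distr k s \<alpha> =
     distr (measure_pmf (block_seed s \<alpha>)) (pvalue_space s) (block_pvalues k s (real k * \<alpha> / real s))"

lemma measure_block_seed:
  assumes "1 \<le> s" "0 \<le> \<alpha>" "\<alpha> \<le> 1"
  shows "measure (measure_pmf (block_seed s \<alpha>)) {(b, j). b \<and> Q j}
    = \<alpha> * real (card {j \<in> {..<s}. Q j}) / real s"
proof -
  have "{(b, j). b \<and> Q j} = {True} \<times> Collect Q"
    by auto
  then have "measure (measure_pmf (block_seed s \<alpha>)) {(b, j). b \<and> Q j} =
      measure (bernoulli_pmf \<alpha>) {True} * measure (pmf_of_set {..<s}) (Collect Q)"
    by (simp add: block_seed_def measure_pmf_prob_product)
  also have "\<dots> = \<alpha> * (real (card {j \<in> {..<s}. Q j}) / real s)"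
    using assms by (subst measure_pmf_of_set) (auto simp: measure_pmf_single lessThan_empty_iff Int_def)
  finally show ?thesis by simp
qed

lemma space_pvalue_space: "space (pvalue_space s) = {1..s} \<rightarrow>\<^sub>E {0..1}"
  by (simp add: pvalue_space_def space_PiM space_restrict_space)

lemma measurable_pvalue_component:
  assumes "i \<in> {1..s}"
  shows "(\<lambda>x. x i) \<in> borel_measurable (pvalue_space s)"
proof -
  have "(\<lambda>x. x i) \<in> pvalue_space s \<rightarrow>\<^sub>M restrict_space borel {0..1}"
    unfolding pvalue_space_def using assms by (rule measurable_component_singleton)
  then show ?thesis
    by (simp add: measurable_restrict_space2_iff)
qed

lemma measurable_block_pvalues:
  assumes "0 \<le> t" "t \<le> 1"
  shows "block_pvalues k s t \<in> measure_pmf Q \<rightarrow>\<^sub>M pvalue_space s"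
  using assms by (auto simp: space_pvalue_space block_pvalues_def)

lemma measure_block_distr:
  assumes "1 \<le> k" "k \<le> s" "0 < \<alpha>" "\<alpha> < 1"
    and "{x \<in> space (pvalue_space s). Q x} \<in> sets (pvalue_space s)"
  shows "measure (block_distr k s \<alpha>) {x \<in> space (block_distr k s \<alpha>). Q x} =
    measure (measure_pmf (block_seed s \<alpha>)) {z. Q (block_pvalues k s (real k * \<alpha> / real s) z)}"
proof -
  note t = critical_value_bounds[OF assms(1-4), THEN less_imp_le]
  have "block_pvalues k s (real k * \<alpha> / real s) z \<in> space (pvalue_space s)" for z
    using measurable_space[OF measurable_block_pvalues[OF t]] by simp
  then show ?thesis
    unfolding block_distr_def using measurable_block_pvalues[OF t] assms
    by (subst measure_distr) (auto intro!: arg_cong[where f = "measure _"])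
qed

text \<open>All hypotheses are true under the single model \<open>P\<close>. Averaging over the rotation \<open>j\<close> for a fixed
  index gives each p-value the value \<open>k\<alpha>/s\<close> with probability \<open>\<alpha> \<cdot> k/s\<close>, which is the largest
  probability that validity permits; counting indices for a fixed \<open>j\<close> shows that exactly \<open>k\<close>
  rejections occur whenever the coin shows true, an event of probability \<open>\<alpha>\<close>.\<close>

lemma block_distr_sharp:
  fixes \<alpha> :: real
  assumes s: "1 \<le> k" "k \<le> s" and \<alpha>: "0 < \<alpha>" "\<alpha> < 1"
  defines "P \<equiv> block_distr k s \<alpha>"
  shows "multiple_testing (pvalue_space s) s {P} (\<lambda>_. {P}) (\<lambda>i x. x i)"
    and "valid_pvalues s (\<lambda>_. {P}) (\<lambda>i x. x i)"
    and "kFWER k s (\<lambda>_. {P}) (single_step k s \<alpha> (\<lambda>i x. x i)) P = \<alpha>"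
proof -
  define t where "t = real k * \<alpha> / real s"
  have t: "0 < t" "t < 1"
    using critical_value_bounds[OF s \<alpha>] by (simp_all add: t_def)
  have sub: "{x \<in> space (pvalue_space s). x i \<le> u} \<in> sets (pvalue_space s)"
    if "i \<in> {1..s}" for i u
    using measurable_pvalue_component[OF that] by measurable
  note P = measure_block_distr[OF s \<alpha>, folded P_def t_def]
  show "multiple_testing (pvalue_space s) s {P} (\<lambda>_. {P}) (\<lambda>i x. x i)"
  proof (rule multiple_testing.intro)
    fix Q assume "Q \<in> {P}"
    then show "prob_space Q"
      unfolding P_def block_distr_def t_def[symmetric]
      using measurable_block_pvalues t by (auto intro!: measure_pmf.prob_space_distr)
    show "sets Q = sets (pvalue_space s)"
      using \<open>Q \<in> {P}\<close> by (simp add: P_def block_distr_def)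
  next
    fix i x assume "i \<in> {1..s}" "x \<in> space (pvalue_space s)"
    then show "x i \<in> {0..1}"
      unfolding space_pvalue_space by (rule PiE_mem[rotated])
  qed (simp_all add: measurable_pvalue_component)
  show "valid_pvalues s (\<lambda>_. {P}) (\<lambda>i x. x i)"
    unfolding valid_pvalues_def
  proof (intro ballI)
    fix i u Q assume i: "i \<in> {1..s}" and u: "u \<in> {0<..<1::real}" and "Q \<in> {P}"
    have "measure P {x \<in> space P. x i \<le> u}
        = measure (measure_pmf (block_seed s \<alpha>)) {z. block_pvalues k s t z i \<le> u}"
      using sub[OF i] by (rule P)
    \<comment> \<open>The atom at \<open>1\<close> never counts because \<open>u < 1\<close>.\<close>
    also have "{z. block_pvalues k s t z i \<le> u} = {(b, j). b \<and> ((i + j) mod s < k \<and> t \<le> u)}"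
      using i u by (auto simp: block_pvalues_def split: if_splits)
    also have "measure (measure_pmf (block_seed s \<alpha>)) \<dots>
        = \<alpha> * real (card {j \<in> {..<s}. (i + j) mod s < k \<and> t \<le> u}) / real s"
      using s \<alpha> by (intro measure_block_seed) auto
    also have "\<dots> \<le> u"
    proof (cases "t \<le> u")
      case True
      then show ?thesis
        using card_cyclic_block[OF s(2), of 0 i]
        by (simp add: t_def lessThan_atLeast0 ac_simps)
    qed (use u in auto)
    finally show "measure Q {x \<in> space Q. x i \<le> u} \<le> u"
      using \<open>Q \<in> {P}\<close> by simp
  qed
  have R: "single_step k s \<alpha> (\<lambda>i x. x i) x \<inter> true_nulls s (\<lambda>_. {P}) P = {i \<in> {1..s}. x i \<le> t}" for x
    by (auto simp: single_step_def true_nulls_def t_def)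
  have "{x \<in> space (pvalue_space s). k \<le> card {i \<in> {1..s}. x i \<le> t}}
      = {x \<in> space (pvalue_space s). k \<le> card {i \<in> {1..s}. x \<in> {x \<in> space (pvalue_space s). x i \<le> t}}}"
    by (auto cong: conj_cong)
  also have "\<dots> \<in> sets (pvalue_space s)"
    by (rule measurable_card_ge) (auto simp: sub)
  finally have "kFWER k s (\<lambda>_. {P}) (single_step k s \<alpha> (\<lambda>i x. x i)) P = measure
      (measure_pmf (block_seed s \<alpha>)) {z. k \<le> card {i \<in> {1..s}. block_pvalues k s t z i \<le> t}}"
    unfolding kFWER_def R by (rule P)
  also have "{z. k \<le> card {i \<in> {1..s}. block_pvalues k s t z i \<le> t}} = {(b, j). b \<and> True}"
  proof -
    have "{i \<in> {1..s}. block_pvalues k s t (b, j) i \<le> t}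
        = (if b then {i \<in> {1..<1 + s}. (i + j) mod s < k} else {})" for b j
      using t by (auto simp: block_pvalues_def split: if_splits)
    then have "k \<le> card {i \<in> {1..s}. block_pvalues k s t (b, j) i \<le> t} \<longleftrightarrow> b" for b j
      using s card_cyclic_block[OF s(2), of 1 j] by simp
    then show ?thesis by auto
  qed
  also have "measure (measure_pmf (block_seed s \<alpha>)) \<dots> = \<alpha>"
    using s \<alpha> by (subst measure_block_seed) auto
  finally show "kFWER k s (\<lambda>_. {P}) (single_step k s \<alpha> (\<lambda>i x. x i)) P = \<alpha>" .
qed

section \<open>Control and sharpness\<close>

theorem theorem2p1:
  fixes s k :: nat and \<alpha> :: real
  assumes "1 \<le> s" and "1 \<le> k" and "k \<le> s" and "0 < \<alpha>" and "\<alpha> < 1"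
  shows
    "(\<forall>(M :: 'a measure) \<Omega> \<omega> p.
        multiple_testing M s \<Omega> \<omega> p \<and> valid_pvalues s \<omega> p \<longrightarrow>
        (\<forall>P\<in>\<Omega>. kFWER k s \<omega> (single_step k s \<alpha> p) P \<le> \<alpha>)) \<and>
     (\<exists>\<Omega> \<omega>.
        multiple_testing (pvalue_space s) s \<Omega> \<omega> (\<lambda>i x. x i) \<and>
        valid_pvalues s \<omega> (\<lambda>i x. x i) \<and>
        (\<exists>P\<in>\<Omega>. kFWER k s \<omega> (single_step k s \<alpha> (\<lambda>i x. x i)) P = \<alpha>))"
proof (intro conjI allI impI ballI)
  fix M :: "'a measure" and \<Omega> \<omega> p P
  assume "multiple_testing M s \<Omega> \<omega> p \<and> valid_pvalues s \<omega> p" and "P \<in> \<Omega>"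
  then show "kFWER k s \<omega> (single_step k s \<alpha> p) P \<le> \<alpha>"
    using assms by (auto intro: kFWER_single_step_le)
next
  show "\<exists>\<Omega> \<omega>.
        multiple_testing (pvalue_space s) s \<Omega> \<omega> (\<lambda>i x. x i) \<and>
        valid_pvalues s \<omega> (\<lambda>i x. x i) \<and>
        (\<exists>P\<in>\<Omega>. kFWER k s \<omega> (single_step k s \<alpha> (\<lambda>i x. x i)) P = \<alpha>)"
    using block_distr_sharp[OF assms(2-5)] by blast
qed

end
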